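(* (Weak supercommutativity.) Let $(V,Y(\cdot,(x,\varphi^+,\varphi^-)),\mathbf{1})$ be an $N=2$ vertex superalgebra with two odd formal variables, and let $u,v\in V$. There exists a positive integer $k$ such that $$(x_1-x_2-\varphi_1^+\varphi_2^--\varphi_1^-\varphi_2^+)^k\big[Y(u,(x_1,\varphi_1^+,\varphi_1^-)),Y(v,(x_2,\varphi_2^+,\varphi_2^-))\big]=0.$$ Furthermore, this weak supercommutativity follows from the truncation condition and the Jacobi identity.
   Context: Grassmann algebra: $\bigwedge_L$ ($L\in\mathbb{N}$) is the exterior algebra over $\mathbb{C}$ on $L$ generators, $\bigwedge_L\subset\bigwedge_{L+1}$, $\bigwedge_\infty=\bigcup_L\bigwedge_L$; $\bigwedge_*$ is one of these, with even and odd parts $\bigwedge_*^0,\bigwedge_*^1$. For $V=V^0\oplus V^1$ write $\eta(v)=j$ if $v\in V^j$. $[A,B]=AB-(-1)^{\eta(A)\eta(B)}BA$ is the supercommutator (extended bilinearly; the vertex operator of homogeneous $v$ has parity $\eta(v)$). Formal variables: $x,x_0,x_1,x_2$ are even (commute with everything); $\varphi^\pm,\varphi_1^\pm,\varphi_2^\pm$ are odd (commute with even variables and even elements; anticommute with each other, with $\bigwedge_*^1$ and with odd endomorphisms; squares vanish). $\delta(x)=\sum_{n\in\mathbb{Z}}x^n$; expressions containing products of odd variables are Taylor expanded about the even variables, and powers of a sum of two even variables are expanded in nonnegative powers of the second one, e.g. $\delta\big(\frac{x_1-x_2-\nu}{x_0}\big)=\sum_n(x_1-x_2-\nu)^nx_0^{-n}$.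 An $N=2$ vertex superalgebra over $\bigwedge_*$ with two odd formal variables, $(V,Y(\cdot,(x,\varphi^+,\varphi^-)),\mathbf{1})$, consists of a $\mathbb{Z}_2$-graded $\bigwedge_*$-module $V=V^0\oplus V^1$, a linear map $v\mapsto Y(v,(x,\varphi^+,\varphi^-))=\sum_{n\in\mathbb{Z}}(v_n+\varphi^+v^+_{n-\frac12}+\varphi^-v^-_{n-\frac12}+\varphi^+\varphi^-v^{+-}_{n-1})x^{-n-1}\in(\mathrm{End}\,V)[[x,x^{-1}]][\varphi^+,\varphi^-]$ with $v_n,v^{+-}_n\in(\mathrm{End}\,V)^{\eta(v)}$ and $v^\pm_{n-\frac12}\in(\mathrm{End}\,V)^{\eta(v)+1\bmod2}$ for homogeneous $v$, and $\mathbf{1}\in V$, such that for $u,v\in V$: (truncation) $u_nv=u^{+-}_nv=u^\pm_{n-\frac12}v=0$ for $n$ sufficiently large; (vacuum) $Y(\mathbf{1},(x,\varphi^+,\varphi^-))=\mathrm{id}_V$; (creation) $Y(v,(x,\varphi^+,\varphi^-))\mathbf{1}\in V[[x]][\varphi^+,\varphi^-]$ and its value at $(x,\varphi^+,\varphi^-)=0$ is $v$; (Jacobi identity) for $u,v$ of homogeneous sign $$x_0^{-1}\delta\Big(\tfrac{x_1-x_2-\varphi_1^+\varphi_2^--\varphi_1^-\varphi_2^+}{x_0}\Big)Y(u,(x_1,\varphi_1^+,\varphi_1^-))Y(v,(x_2,\varphi_2^+,\varphi_2^-))-(-1)^{\eta(u)\eta(v)}x_0^{-1}\delta\Big(\tfrac{x_2-x_1+\varphi_1^+\varphi_2^-+\varphi_1^-\varphi_2^+}{-x_0}\Big)Y(v,(x_2,\varphi_2^+,\varphi_2^-))Y(u,(x_1,\varphi_1^+,\varphi_1^-))$$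 $$=x_2^{-1}\delta\Big(\tfrac{x_1-x_0-\varphi_1^+\varphi_2^--\varphi_1^-\varphi_2^+}{x_2}\Big)Y(Y(u,(x_0,\varphi_1^+-\varphi_2^+,\varphi_1^--\varphi_2^-))v,(x_2,\varphi_2^+,\varphi_2^-)).$$ *)

theory Defs
  imports Complex_Main "HOL-Library.Extended_Nat" "HOL-Library.Z2" "HOL-Library.Groups_Big_Fun"
begin

section \<open>Exterior algebras\<close>

text \<open>Parities are elements of the two-element field; \<open>ksgn i x\<close> is \<open>(-1)\<^sup>i x\<close>.\<close>

definition ksgn :: "bit \<Rightarrow> 'a::uminus \<Rightarrow> 'a" where
  "ksgn i x = (if i = 0 then x else - x)"

definition par :: "'i set \<Rightarrow> bit" where
  "par S = of_nat (card S)"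

text \<open>For finite disjoint sets \<open>T\<close>, \<open>R\<close> of anticommuting generators, written as increasing products
  \<open>\<epsilon>\<^sub>T\<close>, \<open>\<epsilon>\<^sub>R\<close>, one has \<open>\<epsilon>\<^sub>T \<epsilon>\<^sub>R = (-1)\<^sup>s \<epsilon>\<^sub>S\<close> with \<open>S = T \<union> R\<close> and \<open>s = shuf T R\<close>.\<close>

definition shuf :: "'i::linorder set \<Rightarrow> 'i set \<Rightarrow> bit" where
  "shuf T R = of_nat (card {p \<in> T \<times> R. snd p < fst p})"

text \<open>The exterior algebra over the complex numbers with generators indexed by \<open>'i\<close>: finite linear
  combinations of the monomials \<open>\<epsilon>\<^sub>S\<close>, with \<open>S\<close> a finite set of generators.\<close>

typedef (overloaded) 'i grassmann =
  "{f :: 'i::linorder set \<Rightarrow> complex. finite {S. f S \<noteq> 0} \<and> (\<forall>S. f S \<noteq> 0 \<longrightarrow> finite S)}"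
  morphisms gcoeff Abs_grassmann
  by (rule exI[of _ "\<lambda>_. 0"]) simp

setup_lifting type_definition_grassmann

lemma gcoeff_infinite: "infinite S \<Longrightarrow> gcoeff a S = 0"
  using gcoeff[of a] by auto

lemma gcoeff_finite: "finite {S. gcoeff a S \<noteq> 0}"
  using gcoeff[of a] by auto

lemma grassmann_eqI: "(\<And>S. finite S \<Longrightarrow> gcoeff a S = gcoeff b S) \<Longrightarrow> a = b"
  by (metis gcoeff_inject gcoeff_infinite ext)

lemma ksgn_0 [simp]: "ksgn 0 x = x"
  by (simp add: ksgn_def)

lemma ksgn_zero [simp]: "ksgn i (0::'a::group_add) = 0"
  by (simp add: ksgn_def)

lemma ksgn_eq_0_iff [simp]: "ksgn i x = 0 \<longleftrightarrow> x = (0::'a::group_add)"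
  by (simp add: ksgn_def)

lemma ksgn_ksgn: "ksgn i (ksgn j x) = ksgn (i + j) (x::'a::group_add)"
  by (cases i; cases j) (auto simp: ksgn_def)

lemma ksgn_add: "ksgn i (x + y) = ksgn i x + ksgn i (y::'a::ab_group_add)"
  by (simp add: ksgn_def)

lemma ksgn_mult_left: "ksgn i x * y = ksgn i (x * (y::'a::ring))"
  by (simp add: ksgn_def)

lemma ksgn_mult_right: "x * ksgn i y = ksgn i (x * (y::'a::ring))"
  by (simp add: ksgn_def)

lemma ksgn_sum: "ksgn i (sum f A) = (\<Sum>x\<in>A. ksgn i (f x :: 'a::ab_group_add))"
  by (simp add: ksgn_def sum_negf)

lemma shuf_empty [simp]: "shuf {} R = 0" "shuf T {} = 0"
  by (simp_all add: shuf_def)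

lemma shuf_union_left:
  assumes "finite T" "finite T'" "finite R" "T \<inter> T' = {}"
  shows "shuf (T \<union> T') R = shuf T R + shuf T' R"
proof -
  have "{p \<in> (T \<union> T') \<times> R. snd p < fst p} =
      {p \<in> T \<times> R. snd p < fst p} \<union> {p \<in> T' \<times> R. snd p < fst p}"
    by auto
  moreover have "card \<dots> = card {p \<in> T \<times> R. snd p < fst p} + card {p \<in> T' \<times> R. snd p < fst p}"
    using assms by (intro card_Un_disjoint) auto
  ultimately show ?thesis
    by (simp add: shuf_def)
qed

lemma shuf_union_right:
  assumes "finite T" "finite R'" "finite R" "R \<inter> R' = {}"
  shows "shuf T (R \<union> R') = shuf T R + shuf T R'"
proof -
  have "{p \<in> T \<times> (R \<union> R'). snd p < fst p} =
      {p \<in> T \<times> R. snd p < fst p} \<union> {p \<in> T \<times> R'. snd p < fst p}"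
    by auto
  moreover have "card \<dots> = card {p \<in> T \<times> R. snd p < fst p} + card {p \<in> T \<times> R'. snd p < fst p}"
    using assms by (intro card_Un_disjoint) auto
  ultimately show ?thesis
    by (simp add: shuf_def)
qed

lift_definition gconst :: "complex \<Rightarrow> 'i::linorder grassmann" is
  "\<lambda>c S. if S = {} then c else 0"
  by simp

lift_definition ggen :: "'i \<Rightarrow> 'i::linorder grassmann" is
  "\<lambda>i S. if S = {i} then 1 else 0"
  by simp

instantiation grassmann :: (linorder) ring_1
begin

lift_definition zero_grassmann :: "'a grassmann" is "\<lambda>_. 0"
  by simp

definition one_grassmann :: "'a grassmann" where
  "one_grassmann = gconst 1"

lift_definition plus_grassmann :: "'a grassmann \<Rightarrow> 'a grassmann \<Rightarrow> 'a grassmann" is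
  "\<lambda>f g S. f S + g S"
proof -
  fix f g :: "'a set \<Rightarrow> complex"
  assume "finite {S. f S \<noteq> 0} \<and> (\<forall>S. f S \<noteq> 0 \<longrightarrow> finite S)"
    "finite {S. g S \<noteq> 0} \<and> (\<forall>S. g S \<noteq> 0 \<longrightarrow> finite S)"
  moreover have "{S. f S + g S \<noteq> 0} \<subseteq> {S. f S \<noteq> 0} \<union> {S. g S \<noteq> 0}"
    by auto
  ultimately show "finite {S. f S + g S \<noteq> 0} \<and> (\<forall>S. f S + g S \<noteq> 0 \<longrightarrow> finite S)"
    by (metis (mono_tags, lifting) add.right_neutral finite_UnI finite_subset)
qed

lift_definition uminus_grassmann :: "'a grassmann \<Rightarrow> 'a grassmann" is "\<lambda>f S. - f S"
  by simp

definition minus_grassmann :: "'a grassmann \<Rightarrow> 'a grassmann \<Rightarrow> 'a grassmann" where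
  "minus_grassmann a b = a + - b"

lift_definition times_grassmann :: "'a grassmann \<Rightarrow> 'a grassmann \<Rightarrow> 'a grassmann" is
  "\<lambda>f g S. \<Sum>T\<in>Pow S. ksgn (shuf T (S - T)) (f T * g (S - T))"
proof -
  fix f g :: "'a set \<Rightarrow> complex"
  assume f: "finite {S. f S \<noteq> 0} \<and> (\<forall>S. f S \<noteq> 0 \<longrightarrow> finite S)"
    and g: "finite {S. g S \<noteq> 0} \<and> (\<forall>S. g S \<noteq> 0 \<longrightarrow> finite S)"
  let ?h = "\<lambda>S. \<Sum>T\<in>Pow S. ksgn (shuf T (S - T)) (f T * g (S - T))"
  have "{S. ?h S \<noteq> 0} \<subseteq> (\<lambda>(T, R). T \<union> R) ` ({S. f S \<noteq> 0} \<times> {S. g S \<noteq> 0})"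
  proof
    fix S assume "S \<in> {S. ?h S \<noteq> 0}"
    then obtain T where "T \<in> Pow S" "ksgn (shuf T (S - T)) (f T * g (S - T)) \<noteq> 0"
      by (metis (mono_tags, lifting) mem_Collect_eq sum.neutral)
    then have "f T \<noteq> 0" "g (S - T) \<noteq> 0" "S = T \<union> (S - T)"
      by auto
    then show "S \<in> (\<lambda>(T, R). T \<union> R) ` ({S. f S \<noteq> 0} \<times> {S. g S \<noteq> 0})"
      by (intro image_eqI[of _ _ "(T, S - T)"]) auto
  qed
  then have 1: "finite {S. ?h S \<noteq> 0}"
    by (rule finite_subset) (use f g in auto)
  have "?h S = 0" if "infinite S" for S
    using that by simp
  then show "finite {S. ?h S \<noteq> 0} \<and> (\<forall>S. ?h S \<noteq> 0 \<longrightarrow> finite S)"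
    using 1 by blast
qed

lemma gcoeff_assoc_aux:
  fixes f g h :: "'a set \<Rightarrow> complex"
  assumes S: "finite S"
  shows "(\<Sum>T\<in>Pow S. ksgn (shuf T (S - T))
            ((\<Sum>U\<in>Pow T. ksgn (shuf U (T - U)) (f U * g (T - U))) * h (S - T))) =
         (\<Sum>U\<in>Pow S. ksgn (shuf U (S - U))
            (f U * (\<Sum>R\<in>Pow (S - U). ksgn (shuf R (S - U - R)) (g R * h (S - U - R)))))"
    (is "?l = ?r")
proof -
  have fin: "finite T" if "T \<subseteq> S" for T
    using S that finite_subset by blast
  have "?l = (\<Sum>T\<in>Pow S. \<Sum>U\<in>Pow T.
      ksgn (shuf T (S - T) + shuf U (T - U)) (f U * g (T - U) * h (S - T)))"
    by (simp add: sum_distrib_right ksgn_sum ksgn_mult_left ksgn_ksgn)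
  also have "\<dots> = (\<Sum>(T, U)\<in>(SIGMA T:Pow S. Pow T).
      ksgn (shuf T (S - T) + shuf U (T - U)) (f U * g (T - U) * h (S - T)))"
    using S fin by (intro sum.Sigma) auto
  also have "\<dots> = (\<Sum>(U, R)\<in>(SIGMA U:Pow S. Pow (S - U)).
      ksgn (shuf U (S - U) + shuf R (S - U - R)) (f U * (g R * h (S - U - R))))"
  proof (rule sum.reindex_bij_witness[where i = "\<lambda>(U, R). (U \<union> R, U)" and j = "\<lambda>(T, U). (U, T - U)"],
      goal_cases)
    case (5 p)
    then obtain T U where p: "p = (T, U)" "T \<subseteq> S" "U \<subseteq> T"
      by auto
    have "shuf T (S - T) = shuf U (S - T) + shuf (T - U) (S - T)"
      using shuf_union_left[of U "T - U" "S - T"] p fin S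
      by (simp add: Un_absorb1 finite_subset subset_trans)
    moreover have "S - U = (T - U) \<union> (S - T)"
      using p by auto
    then have "shuf U (S - U) = shuf U (T - U) + shuf U (S - T)"
      using shuf_union_right[of U "S - T" "T - U"] p fin S
      by (metis (no_types, lifting) Diff_disjoint Diff_subset Int_Diff finite_Diff inf.absorb_iff1
          subset_trans Int_commute Diff_Int_distrib)
    moreover have "S - U - (T - U) = S - T"
      using p by auto
    ultimately have "shuf T (S - T) + shuf U (T - U) = shuf U (S - U) + shuf (T - U) (S - U - (T - U))"
      by (simp only: ac_simps)
    then show ?case
      using p \<open>S - U - (T - U) = S - T\<close> by (simp only: prod.case mult.assoc)
  qed (auto simp: Un_absorb1)
  also have "\<dots> = (\<Sum>U\<in>Pow S. \<Sum>R\<in>Pow (S - U).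
      ksgn (shuf U (S - U) + shuf R (S - U - R)) (f U * (g R * h (S - U - R))))"
    using S fin by (intro sum.Sigma[symmetric]) auto
  also have "\<dots> = ?r"
    by (simp add: sum_distrib_left ksgn_sum ksgn_mult_right ksgn_ksgn)
  finally show ?thesis .
qed

instance
proof
  fix a b c :: "'a grassmann"
  show "a * b * c = a * (b * c)"
    by (rule grassmann_eqI) (simp add: times_grassmann.rep_eq gcoeff_assoc_aux)
  show "1 * a = a"
  proof (rule grassmann_eqI)
    fix S :: "'a set" assume "finite S"
    then have "gcoeff (1 * a) S = (\<Sum>T\<in>{{}}. ksgn (shuf T (S - T)) (gcoeff a (S - T)))"
      unfolding times_grassmann.rep_eq one_grassmann_def gconst.rep_eq
      by (intro sum.mono_neutral_cong_right) auto
    then show "gcoeff (1 * a) S = gcoeff a S"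
      by simp
  qed
  show "a * 1 = a"
  proof (rule grassmann_eqI)
    fix S :: "'a set" assume "finite S"
    then have "gcoeff (a * 1) S = (\<Sum>T\<in>{S}. ksgn (shuf T (S - T)) (gcoeff a T))"
      unfolding times_grassmann.rep_eq one_grassmann_def gconst.rep_eq
      by (intro sum.mono_neutral_cong_right) auto
    then show "gcoeff (a * 1) S = gcoeff a S"
      by simp
  qed
  show "(a + b) * c = a * c + b * c"
    by (rule grassmann_eqI)
      (simp add: times_grassmann.rep_eq plus_grassmann.rep_eq distrib_right ksgn_add sum.distrib)
  show "a * (b + c) = a * b + a * c"
    by (rule grassmann_eqI)
      (simp add: times_grassmann.rep_eq plus_grassmann.rep_eq distrib_left ksgn_add sum.distrib)
  show "(0::'a grassmann) \<noteq> 1"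
  proof
    assume "(0::'a grassmann) = 1"
    then have "gcoeff (0::'a grassmann) {} = gcoeff (1::'a grassmann) {}"
      by simp
    then show False
      by (simp add: one_grassmann_def zero_grassmann.rep_eq gconst.rep_eq)
  qed
qed (rule grassmann_eqI;
     simp add: plus_grassmann.rep_eq zero_grassmann.rep_eq uminus_grassmann.rep_eq minus_grassmann_def)+

end

text \<open>\<open>Lam L\<close> is the exterior algebra on \<open>L\<close> generators (numbered from \<open>0\<close>), inside
  \<open>Lam \<infinity>\<close>, the union of all of them. \<open>LamP L i\<close> is its even or odd part.\<close>

definition Lam :: "enat \<Rightarrow> nat grassmann set" where
  "Lam L = {a. \<forall>S. gcoeff a S \<noteq> 0 \<longrightarrow> (\<forall>i\<in>S. enat i < L)}"

definition LamP :: "enat \<Rightarrow> bit \<Rightarrow> nat grassmann set" where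
  "LamP L i = {a \<in> Lam L. \<forall>S. gcoeff a S \<noteq> 0 \<longrightarrow> par S = i}"


section \<open>Graded modules over a Grassmann algebra\<close>

text \<open>The module is the whole type \<open>'v\<close>. Only the values \<open>smul a v\<close> with \<open>a \<in> Lam L\<close> are
  meaningful.\<close>

locale graded_module =
  fixes L :: enat
    and smul :: "nat grassmann \<Rightarrow> 'v::ab_group_add \<Rightarrow> 'v"
    and V :: "bit \<Rightarrow> 'v set"
  assumes smul_add_right: "a \<in> Lam L \<Longrightarrow> smul a (v + w) = smul a v + smul a w"
    and smul_add_left: "a \<in> Lam L \<Longrightarrow> b \<in> Lam L \<Longrightarrow> smul (a + b) v = smul a v + smul b v"
    and smul_smul: "a \<in> Lam L \<Longrightarrow> b \<in> Lam L \<Longrightarrow> smul a (smul b v) = smul (a * b) v"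
    and smul_one: "smul 1 v = v"
    and V_zero: "0 \<in> V i"
    and V_add: "v \<in> V i \<Longrightarrow> w \<in> V i \<Longrightarrow> v + w \<in> V i"
    and V_smul: "a \<in> LamP L i \<Longrightarrow> v \<in> V j \<Longrightarrow> smul a v \<in> V (i + j)"
    and V_span: "\<exists>v0\<in>V 0. \<exists>v1\<in>V 1. v = v0 + v1"
    and V_direct: "V 0 \<inter> V 1 = {0}"

definition vpart :: "(bit \<Rightarrow> 'v::ab_group_add set) \<Rightarrow> bit \<Rightarrow> 'v \<Rightarrow> 'v" where
  "vpart V i v = (THE w. w \<in> V i \<and> v - w \<in> V (i + 1))"

text \<open>The component of parity \<open>i\<close> of an endomorphism.\<close>

definition epart :: "(bit \<Rightarrow> 'v::ab_group_add set) \<Rightarrow> bit \<Rightarrow> ('v \<Rightarrow> 'v) \<Rightarrow> 'v \<Rightarrow> 'v" where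
  "epart V i f w = (\<Sum>k\<in>{0, 1}. vpart V (i + k) (f (vpart V k w)))"


section \<open>Formal calculus in three even and four odd variables\<close>

datatype evar = X0 | X1 | X2

text \<open>\<open>P1\<close>, \<open>M1\<close>, \<open>P2\<close>, \<open>M2\<close> index the odd variables
  \<open>\<phi>\<^sub>1\<^sup>+\<close>, \<open>\<phi>\<^sub>1\<^sup>-\<close>, \<open>\<phi>\<^sub>2\<^sup>+\<close>, \<open>\<phi>\<^sub>2\<^sup>-\<close>, in this order.\<close>

datatype ovar = P1 | M1 | P2 | M2

instantiation ovar :: linorder
begin

primrec ovar_rank :: "ovar \<Rightarrow> nat" where
  "ovar_rank P1 = 0" | "ovar_rank M1 = 1" | "ovar_rank P2 = 2" | "ovar_rank M2 = 3"

definition less_eq_ovar :: "ovar \<Rightarrow> ovar \<Rightarrow> bool" where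
  "a \<le> b \<longleftrightarrow> ovar_rank a \<le> ovar_rank b"

definition less_ovar :: "ovar \<Rightarrow> ovar \<Rightarrow> bool" where
  "a < b \<longleftrightarrow> ovar_rank a < ovar_rank b"

instance
proof
  fix a b :: ovar
  show "a \<le> b \<Longrightarrow> b \<le> a \<Longrightarrow> a = b"
    by (cases a; cases b) (auto simp: less_eq_ovar_def)
qed (auto simp: less_eq_ovar_def less_ovar_def)

end

text \<open>A formal series in the even variables assigns a coefficient to every monomial
  \<open>\<Prod>\<^sub>a x\<^sub>a\<^bsup>e a\<^esup>\<close>. In an \<open>End V\<close>-valued series, \<open>A e S\<close> is the coefficient of this monomial
  times \<open>\<phi>\<^sub>S\<close>, the odd monomial \<open>\<phi>\<^sub>S\<close> standing to the left of the endomorphism.\<close>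

type_synonym sseries = "(evar \<Rightarrow> int) \<Rightarrow> ovar grassmann"
type_synonym 'v eseries = "(evar \<Rightarrow> int) \<Rightarrow> ovar set \<Rightarrow> 'v \<Rightarrow> 'v"

text \<open>The series \<open>(x\<^sub>a - x\<^sub>b - \<nu>)\<^sup>n\<close> with integer \<open>n\<close>: Taylor expanded in the nilpotent even element
  \<open>\<nu>\<close>, then in nonnegative powers of \<open>x\<^sub>b\<close>. For each exponent \<open>e\<close> at most one pair \<open>(k, j)\<close> counts.\<close>

definition spow :: "evar \<Rightarrow> evar \<Rightarrow> ovar grassmann \<Rightarrow> int \<Rightarrow> sseries" where
  "spow a b \<nu> n = (\<lambda>e. Sum_any (\<lambda>(k::nat, j::nat).
     if e = (\<lambda>_. 0)(a := n - int k - int j, b := int j)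
     then gconst ((of_int n gchoose k) * (of_int (n - int k) gchoose j) * (- 1) ^ j) * (- \<nu>) ^ k
     else 0))"

text \<open>\<open>x\<^sub>c\<^sup>-\<^sup>1 \<delta>((x\<^sub>a - x\<^sub>b - \<nu>) / ((-1)\<^sup>s x\<^sub>c))\<close>, for \<open>a\<close>, \<open>b\<close>, \<open>c\<close> distinct: the sum of
  \<open>(-1)\<^sup>s\<^sup>n (x\<^sub>a - x\<^sub>b - \<nu>)\<^sup>n x\<^sub>c\<^sup>-\<^sup>n\<^sup>-\<^sup>1\<close> over all integers \<open>n\<close>.\<close>

definition sdelta :: "bit \<Rightarrow> evar \<Rightarrow> evar \<Rightarrow> ovar grassmann \<Rightarrow> evar \<Rightarrow> sseries" where
  "sdelta s a b \<nu> c = (\<lambda>e. let n = - e c - 1 in ksgn (s * of_int n) (spow a b \<nu> n (e(c := 0))))"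

text \<open>Products of series, evaluated at a vector \<open>w\<close>. For all products used below the sums over
  exponents \<open>q\<close> have finite support, by the truncation condition (for infinite support \<open>Sum_any\<close>
  would be \<open>0\<close>). Moving an endomorphism of parity \<open>i\<close> to the right past \<open>\<phi>\<^sub>R\<close> costs the sign
  \<open>(-1)\<close> to the power \<open>i\<close> times the cardinality of \<open>R\<close>.\<close>

definition scmult :: "(nat grassmann \<Rightarrow> 'v::ab_group_add \<Rightarrow> 'v) \<Rightarrow> sseries \<Rightarrow> 'v eseries \<Rightarrow> 'v eseries" where
  "scmult smul c A = (\<lambda>e S w. Sum_any (\<lambda>q. \<Sum>T\<in>Pow S.
     ksgn (shuf T (S - T)) (smul (gconst (gcoeff (c q) T)) (A (e - q) (S - T) w))))"

definition emult :: "(bit \<Rightarrow> 'v::ab_group_add set) \<Rightarrow> 'v eseries \<Rightarrow> 'v eseries \<Rightarrow> 'v eseries" where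
  "emult V A B = (\<lambda>e S w. Sum_any (\<lambda>q. \<Sum>T\<in>Pow S. \<Sum>i\<in>{0, 1}.
     ksgn (shuf T (S - T) + i * par (S - T)) (epart V i (A q T) (B (e - q) (S - T) w))))"

text \<open>The component of parity \<open>i\<close>, counting the parity of the odd variables, and the
  supercommutator \<open>A B - (-1)\<^sup>i\<^sup>j B A\<close>, for \<open>A\<close>, \<open>B\<close> of parity \<open>i\<close>, \<open>j\<close>, extended bilinearly.\<close>

definition espart :: "(bit \<Rightarrow> 'v::ab_group_add set) \<Rightarrow> bit \<Rightarrow> 'v eseries \<Rightarrow> 'v eseries" where
  "espart V i A = (\<lambda>e S. epart V (i + par S) (A e S))"

definition supercomm :: "(bit \<Rightarrow> 'v::ab_group_add set) \<Rightarrow> 'v eseries \<Rightarrow> 'v eseries \<Rightarrow> 'v eseries" where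
  "supercomm V A B = (\<lambda>e S w. \<Sum>i\<in>{0, 1}. \<Sum>j\<in>{0, 1}.
     emult V (espart V i A) (espart V j B) e S w -
     ksgn (i * j) (emult V (espart V j B) (espart V i A) e S w))"


section \<open>N=2 vertex superalgebras with two odd formal variables\<close>

text \<open>A field \<open>F\<close> in \<open>(End V)[[x, x\<^sup>-\<^sup>1]][\<phi>\<^sup>+, \<phi>\<^sup>-]\<close> is given by its modes: \<open>F n T\<close> is the
  coefficient of \<open>\<phi>\<^sup>T x\<^sup>-\<^sup>n\<^sup>-\<^sup>1\<close>, where \<open>\<phi>\<^sup>T\<close> is \<open>1\<close>, \<open>\<phi>\<^sup>+\<close>, \<open>\<phi>\<^sup>-\<close>, \<open>\<phi>\<^sup>+\<phi>\<^sup>-\<close> respectively. So for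
  \<open>F = Y v\<close> these are \<open>v\<^sub>n\<close>, and the modes denoted by \<open>v\<^sup>+\<close>, \<open>v\<^sup>-\<close> with index \<open>n - 1/2\<close> and by \<open>v\<^sup>+\<^sup>-\<close>
  with index \<open>n - 1\<close>.\<close>

datatype pm = Pl | Mi

type_synonym 'v field = "int \<Rightarrow> pm set \<Rightarrow> 'v \<Rightarrow> 'v"

definition opow :: "ovar grassmann \<Rightarrow> ovar grassmann \<Rightarrow> pm set \<Rightarrow> ovar grassmann" where
  "opow p m T = (if Pl \<in> T then p else 1) * (if Mi \<in> T then m else 1)"

text \<open>Evaluation of a field at \<open>(x\<^sub>a, p, m)\<close>.\<close>

definition field_at ::
  "(nat grassmann \<Rightarrow> 'v::ab_group_add \<Rightarrow> 'v) \<Rightarrow> 'v field \<Rightarrow> evar \<Rightarrow> ovar grassmann \<Rightarrow> ovar grassmann \<Rightarrow> 'v eseries"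
where
  "field_at smul F a p m = (\<lambda>e S w.
     if e = (\<lambda>_. 0)(a := e a)
     then \<Sum>T\<in>UNIV. smul (gconst (gcoeff (opow p m T) S)) (F (- e a - 1) T w)
     else 0)"

abbreviation "field_at1 smul F \<equiv> field_at smul F X1 (ggen P1) (ggen M1)"
abbreviation "field_at2 smul F \<equiv> field_at smul F X2 (ggen P2) (ggen M2)"

text \<open>\<open>\<phi>\<^sub>1\<^sup>+ \<phi>\<^sub>2\<^sup>- + \<phi>\<^sub>1\<^sup>- \<phi>\<^sub>2\<^sup>+\<close>\<close>

definition nu :: "ovar grassmann" where
  "nu = ggen P1 * ggen M2 + ggen M1 * ggen P2"

text \<open>\<open>Y(Y(u, (x\<^sub>0, \<phi>\<^sub>1\<^sup>+ - \<phi>\<^sub>2\<^sup>+, \<phi>\<^sub>1\<^sup>- - \<phi>\<^sub>2\<^sup>-)) v, (x\<^sub>2, \<phi>\<^sub>2\<^sup>+, \<phi>\<^sub>2\<^sup>-))\<close>, where \<open>Y\<close> is extended to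
  \<open>V\<close>-valued series linearly over the formal variables.\<close>

definition iterate ::
  "(nat grassmann \<Rightarrow> 'v::ab_group_add \<Rightarrow> 'v) \<Rightarrow> ('v \<Rightarrow> 'v field) \<Rightarrow> 'v \<Rightarrow> 'v \<Rightarrow> 'v eseries"
where
  "iterate smul Y u v = (\<lambda>e S w. Sum_any (\<lambda>q. \<Sum>T\<in>Pow S. ksgn (shuf T (S - T))
     (field_at2 smul
        (Y (field_at smul (Y u) X0 (ggen P1 - ggen P2) (ggen M1 - ggen M2) q T v))
        (e - q) (S - T) w)))"

text \<open>The data: a map \<open>Y\<close>, linear over the Grassmann algebra, that respects parities.
  The sign in \<open>Y_smul\<close> comes from \<open>a \<phi>\<^sup>T = (-1)\<^sup>i\<^sup>t \<phi>\<^sup>T a\<close>, where \<open>i\<close> is the parity of \<open>a\<close> and \<open>t\<close> that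
  of \<open>T\<close>. Endomorphisms of \<open>V\<close> are only required to be linear over the complex numbers; by weak
  supercommutativity with \<open>Y (smul a vac)\<close>, those occurring in vertex operators of a vertex
  superalgebra commute with the Grassmann algebra up to the usual sign.\<close>

locale N2_vertex_operators = graded_module L smul V
  for L :: enat and smul :: "nat grassmann \<Rightarrow> 'v::ab_group_add \<Rightarrow> 'v" and V :: "bit \<Rightarrow> 'v set" +
  fixes Y :: "'v \<Rightarrow> 'v field"
  assumes Y_add: "Y (u + v) n T w = Y u n T w + Y v n T w"
    and Y_smul: "a \<in> LamP L i \<Longrightarrow> Y (smul a v) n T w = ksgn (i * par T) (smul a (Y v n T w))"
    and End_add: "Y v n T (w + w') = Y v n T w + Y v n T w'"
    and End_scale: "Y v n T (smul (gconst c) w) = smul (gconst c) (Y v n T w)"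
    and Y_parity: "v \<in> V i \<Longrightarrow> w \<in> V j \<Longrightarrow> Y v n T w \<in> V (i + par T + j)"

definition truncation :: "('v::ab_group_add \<Rightarrow> 'v field) \<Rightarrow> bool" where
  "truncation Y \<longleftrightarrow> (\<forall>u v. \<exists>N. \<forall>n\<ge>N. \<forall>T. Y u n T v = 0)"

definition jacobi ::
  "(nat grassmann \<Rightarrow> 'v::ab_group_add \<Rightarrow> 'v) \<Rightarrow> (bit \<Rightarrow> 'v set) \<Rightarrow> ('v \<Rightarrow> 'v field) \<Rightarrow> bool"
where
  "jacobi smul V Y \<longleftrightarrow> (\<forall>i j. \<forall>u\<in>V i. \<forall>v\<in>V j. \<forall>e S w.
     scmult smul (sdelta 0 X1 X2 nu X0)
       (emult V (field_at1 smul (Y u)) (field_at2 smul (Y v))) e S w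
     - ksgn (i * j) (scmult smul (sdelta 1 X2 X1 (- nu) X0)
       (emult V (field_at2 smul (Y v)) (field_at1 smul (Y u))) e S w)
     = scmult smul (sdelta 0 X1 X0 nu X2) (iterate smul Y u v) e S w)"

locale N2_vertex_superalgebra = N2_vertex_operators L smul V Y
  for L :: enat and smul :: "nat grassmann \<Rightarrow> 'v::ab_group_add \<Rightarrow> 'v" and V :: "bit \<Rightarrow> 'v set"
    and Y :: "'v \<Rightarrow> 'v field" +
  fixes vac :: 'v
  assumes truncation: "truncation Y"
    and vacuum: "Y vac n T w = (if n = - 1 \<and> T = {} then w else 0)"
    and creation: "n \<ge> 0 \<Longrightarrow> Y v n T vac = 0" "Y v (- 1) {} vac = v"
    and jacobi: "jacobi smul V Y"

definition weak_supercommutativity ::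
  "(nat grassmann \<Rightarrow> 'v::ab_group_add \<Rightarrow> 'v) \<Rightarrow> (bit \<Rightarrow> 'v set) \<Rightarrow> ('v \<Rightarrow> 'v field) \<Rightarrow> 'v \<Rightarrow> 'v \<Rightarrow> bool"
where
  "weak_supercommutativity smul V Y u v \<longleftrightarrow> (\<exists>k::nat. k > 0 \<and> (\<forall>e S w.
     scmult smul (spow X1 X2 nu (int k))
       (supercomm V (field_at1 smul (Y u)) (field_at2 smul (Y v))) e S w = 0))"

end

theory Submission
  imports Defs
begin

text \<open>Taking the coefficient of \<open>x\<^sub>0\<^sup>-\<^sup>k\<^sup>-\<^sup>1\<close> in the Jacobi identity turns both delta functions on the
  left into \<open>(x\<^sub>1 - x\<^sub>2 - \<nu>)\<^sup>k\<close>, which for \<open>k \<ge> 0\<close> is the same polynomial in either expansion. On the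
  right the delta function has only nonnegative powers of \<open>x\<^sub>0\<close>, so that only modes \<open>u\<^sub>n v\<close> with
  \<open>n \<ge> k\<close> contribute; these vanish for large \<open>k\<close>.\<close>

text \<open>Parities stay in ring notation, so that sign computations can use the additive laws of
  \<open>bit\<close> instead of being rewritten to bit operations.\<close>

declare add_bit_eq_xor [simp del] mult_bit_eq_and [simp del]

section \<open>Parity in Grassmann algebras\<close>

lemma gconst_0 [simp]: "gconst 0 = 0"
  by (rule grassmann_eqI) (simp add: gconst.rep_eq zero_grassmann.rep_eq)

lemma gconst_uminus: "gconst (- c) = - gconst c"
  by (rule grassmann_eqI) (simp add: gconst.rep_eq uminus_grassmann.rep_eq)

lemma gconst_in_LamP: "gconst c \<in> LamP L 0"
  by (auto simp: LamP_def Lam_def gconst.rep_eq par_def split: if_splits)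

lemma gconst_in_Lam: "gconst c \<in> Lam L"
  using gconst_in_LamP LamP_def by blast

lemma bit_add_self [simp]: "(i::bit) + i = 0"
  by (cases i) auto

lemma par_Diff:
  assumes "finite S" "T \<subseteq> S"
  shows "par S = par T + par (S - T)"
proof -
  have "card S = card T + card (S - T)"
    using assms by (metis card_Diff_subset card_mono finite_subset le_add_diff_inverse)
  then show ?thesis
    by (simp add: par_def)
qed

text \<open>The counterpart of \<open>LamP\<close> for an arbitrary type of generators; it is needed
  for \<open>ovar grassmann\<close>, where the odd formal variables live. Zero has both
  parities.\<close>

definition has_parity :: "bit \<Rightarrow> 'i::linorder grassmann \<Rightarrow> bool" where
  "has_parity i a \<longleftrightarrow> (\<forall>S. gcoeff a S \<noteq> 0 \<longrightarrow> par S = i)"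

lemma has_parity_mult:
  assumes "has_parity i a" "has_parity j b"
  shows "has_parity (i + j) (a * b)"
  unfolding has_parity_def
proof (intro allI impI)
  fix S assume S: "gcoeff (a * b) S \<noteq> 0"
  then have "finite S"
    using gcoeff_infinite by blast
  moreover obtain T where "T \<subseteq> S" "gcoeff a T \<noteq> 0" "gcoeff b (S - T) \<noteq> 0"
  proof -
    have "\<exists>T\<in>Pow S. ksgn (shuf T (S - T)) (gcoeff a T * gcoeff b (S - T)) \<noteq> 0"
      using S unfolding times_grassmann.rep_eq by (meson sum.neutral)
    then show ?thesis
      using that by auto
  qed
  ultimately show "par S = i + j"
    using assms par_Diff[of S T] by (simp add: has_parity_def)
qed

lemma has_parity_one: "has_parity 0 1"
  by (simp add: has_parity_def one_grassmann_def gconst.rep_eq par_def)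

lemma has_parity_ggen: "has_parity 1 (ggen x)"
  by (simp add: has_parity_def ggen.rep_eq par_def)

lemma has_parity_opow:
  assumes "has_parity 1 p" "has_parity 1 m"
  shows "has_parity (par T) (opow p m T)"
proof -
  have "(UNIV :: pm set) = {Pl, Mi}"
    using pm.exhaust by auto
  then have "T \<in> Pow {Pl, Mi}"
    by simp
  then have "par T = (if Pl \<in> T then 1 else 0) + (if Mi \<in> T then 1 else 0)"
    by (auto simp: Pow_insert par_def)
  then show ?thesis
    using assms has_parity_mult[OF assms] by (simp add: opow_def has_parity_one)
qed


section \<open>Graded modules\<close>

context graded_module
begin

lemma smul_gconst_zero [simp]: "smul (gconst c) 0 = 0"
  using smul_add_right[OF gconst_in_Lam, of c 0 0] by simp

lemma smul_zero_left [simp]: "smul 0 v = 0"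
  using smul_add_left[OF gconst_in_Lam gconst_in_Lam, of 0 0 v] by simp

lemma smul_gconst_uminus: "smul (gconst (- c)) v = - smul (gconst c) v"
proof -
  have "smul (gconst (- c)) v + smul (gconst c) v = 0"
    using smul_add_left[OF gconst_in_Lam gconst_in_Lam, of "- c" c v] by (simp add: gconst_uminus)
  then show ?thesis
    by (simp add: eq_neg_iff_add_eq_0)
qed

lemma smul_gconst_minus_right: "smul (gconst c) (- v) = - smul (gconst c) v"
  using smul_add_right[OF gconst_in_Lam, of c "- v" v] by (simp add: eq_neg_iff_add_eq_0)

lemma smul_gconst_diff: "smul (gconst c) (v - w) = smul (gconst c) v - smul (gconst c) w"
  using smul_add_right[OF gconst_in_Lam, of c v "- w"] by (simp add: smul_gconst_minus_right)

lemma smul_gconst_ksgn: "smul (gconst c) (ksgn i v) = ksgn i (smul (gconst c) v)"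
  by (simp add: ksgn_def smul_gconst_minus_right)

lemma smul_gconst_sum: "smul (gconst c) (sum f A) = (\<Sum>x\<in>A. smul (gconst c) (f x))"
  by (induction A rule: infinite_finite_induct) (auto simp: smul_add_right[OF gconst_in_Lam])

text \<open>Negation is scaling by \<open>gconst (- 1)\<close>, an even element, so it preserves
  each part.\<close>

lemma V_uminus: "v \<in> V i \<Longrightarrow> - v \<in> V i"
  using V_smul[OF gconst_in_LamP, of v i "- 1"] smul_gconst_uminus[of 1 v]
  by (simp add: smul_one flip: one_grassmann_def)

lemma V_diff: "v \<in> V i \<Longrightarrow> w \<in> V i \<Longrightarrow> v - w \<in> V i"
  using V_add[of v i "- w"] V_uminus by simp

lemma V_sum: "(\<And>x. x \<in> A \<Longrightarrow> f x \<in> V i) \<Longrightarrow> sum f A \<in> V i"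
  by (induction A rule: infinite_finite_induct) (auto simp: V_zero V_add)

lemma V_both:
  assumes "v \<in> V i" "v \<in> V (i + 1)"
  shows "v = 0"
proof -
  have "v \<in> V 0 \<inter> V 1"
    using assms by (cases i) auto
  then show ?thesis
    using V_direct by simp
qed

text \<open>Two candidates differ by an element of both \<open>V i\<close> and
  \<open>V (i + 1)\<close>, which is zero because the sum is direct. This gives access to the
  \<open>THE\<close> in \<open>vpart\<close>.\<close>

lemma vpart_eqI:
  assumes "w \<in> V i" "v - w \<in> V (i + 1)"
  shows "vpart V i v = w"
  unfolding vpart_def
proof (rule the_equality)
  fix w' assume w': "w' \<in> V i \<and> v - w' \<in> V (i + 1)"
  have "w' - w \<in> V i"
    using w' assms V_diff by blast
  moreover have "w' - w = (v - w) - (v - w')"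
    by simp
  then have "w' - w \<in> V (i + 1)"
    using w' assms V_diff by metis
  ultimately show "w' = w"
    using V_both by fastforce
qed (use assms in auto)

lemma vpart_mem: "vpart V i v \<in> V i" and vpart_compl: "v - vpart V i v \<in> V (i + 1)"
proof -
  obtain v0 v1 where v: "v0 \<in> V 0" "v1 \<in> V 1" "v = v0 + v1"
    using V_span by blast
  have "vpart V i v = (if i = 0 then v0 else v1)"
    using v by (cases i) (auto intro!: vpart_eqI)
  then show "vpart V i v \<in> V i" "v - vpart V i v \<in> V (i + 1)"
    using v by (cases i; auto)+
qed

lemma vpart_same: "v \<in> V i \<Longrightarrow> vpart V i v = v"
  by (rule vpart_eqI) (auto simp: V_zero)

lemma vpart_other: "v \<in> V (i + 1) \<Longrightarrow> vpart V i v = 0"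
  by (rule vpart_eqI) (auto simp: V_zero)

lemma vpart_zero [simp]: "vpart V i 0 = 0"
  by (rule vpart_same[OF V_zero])

lemma vpart_add: "vpart V i (v + w) = vpart V i v + vpart V i w"
proof (rule vpart_eqI)
  show "vpart V i v + vpart V i w \<in> V i"
    by (simp add: vpart_mem V_add)
  have "v + w - (vpart V i v + vpart V i w) = (v - vpart V i v) + (w - vpart V i w)"
    by simp
  then show "v + w - (vpart V i v + vpart V i w) \<in> V (i + 1)"
    using vpart_compl V_add by metis
qed

lemma vpart_decomp: "vpart V i v + vpart V (i + 1) v = v"
proof -
  have "vpart V (i + 1) v = v - vpart V i v"
    by (rule vpart_eqI) (use vpart_compl[of v i] vpart_mem[of i v] in \<open>auto simp: add.assoc\<close>)
  then show ?thesis
    by simp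
qed

lemma epart_zero_fun: "epart V i (\<lambda>_. 0) w = 0"
  by (simp add: epart_def)


section \<open>Products with formal series of finite support\<close>

text \<open>\<open>Sum_any\<close> is zero on infinite support, hence not additive in general. A
  finitely supported scalar series provides one finite index set for every \<open>A\<close>, so
  linearity in \<open>A\<close> follows below for arbitrary series.\<close>

lemma scmult_finite:
  assumes "finite {q. c q \<noteq> 0}"
  shows "scmult smul c A e S w = (\<Sum>q | c q \<noteq> 0. \<Sum>T\<in>Pow S.
    ksgn (shuf T (S - T)) (smul (gconst (gcoeff (c q) T)) (A (e - q) (S - T) w)))"
  unfolding scmult_def
proof (rule Sum_any.expand_superset[OF assms], rule subsetI, unfold mem_Collect_eq, erule contrapos_nn)
  fix q assume "c q = 0"
  then show "(\<Sum>T\<in>Pow S. ksgn (shuf T (S - T))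
      (smul (gconst (gcoeff (c q) T)) (A (e - q) (S - T) w))) = 0"
    by (simp add: zero_grassmann.rep_eq)
qed

lemma scmult_diff:
  assumes "finite {q. c q \<noteq> 0}"
  shows "scmult smul c (\<lambda>e S w. A e S w - B e S w) e S w =
    scmult smul c A e S w - scmult smul c B e S w"
proof -
  have ksgn_diff: "ksgn i (x - y) = ksgn i x - ksgn i y" for i and x y :: 'v
    by (simp add: ksgn_def)
  show ?thesis
    by (simp add: scmult_finite[OF assms] smul_gconst_diff ksgn_diff sum_subtractf)
qed

lemma scmult_ksgn:
  assumes "finite {q. c q \<noteq> 0}"
  shows "scmult smul c (\<lambda>e S w. ksgn i (A e S w)) e S w = ksgn i (scmult smul c A e S w)"
proof -
  have "ksgn i (ksgn j x) = ksgn j (ksgn i x)" for i j and x :: 'v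
    by (simp add: ksgn_def)
  then show ?thesis
    by (simp add: scmult_finite[OF assms] smul_gconst_ksgn ksgn_sum)
qed

lemma scmult_sum:
  assumes "finite {q. c q \<noteq> 0}"
  shows "scmult smul c (\<lambda>e S w. \<Sum>i\<in>I. A i e S w) e S w = (\<Sum>i\<in>I. scmult smul c (A i) e S w)"
  unfolding scmult_finite[OF assms] smul_gconst_sum ksgn_sum
  by (simp only: sum.swap[of _ I])

end


section \<open>Powers of a difference of two even variables\<close>

text \<open>The expansion uses only nonnegative powers of the second variable.\<close>

lemma spow_eq_0:
  assumes "e b < 0" "a \<noteq> b"
  shows "spow a b \<nu> n e = 0"
proof -
  have "e \<noteq> (\<lambda>_. 0)(a := n - int k - int j, b := int j)" for k j
    using assms by (metis fun_upd_same of_nat_0_le_iff not_le)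
  then show ?thesis
    unfolding spow_def by (simp only: if_False case_prod_unfold) simp
qed

text \<open>The exponents \<open>x\<close>, \<open>y\<close> determine the only contributing pair
  \<open>l = k - x - y\<close>, \<open>j = y\<close>, so the sum collapses to one term. For a
  nonnegative power the generalized binomials kill every term with \<open>x < 0\<close>, and a
  polynomial remains.\<close>

lemma spow_nat:
  assumes "a \<noteq> b"
  shows "spow a b \<nu> (int k) ((\<lambda>_. 0)(a := x, b := y)) =
    (if 0 \<le> x \<and> 0 \<le> y \<and> x + y \<le> int k
     then gconst (of_nat (k choose nat (int k - x - y)) * of_nat (nat (x + y) choose nat y) * (- 1) ^ nat y)
       * (- \<nu>) ^ nat (int k - x - y)
     else 0)"
    (is "spow a b \<nu> (int k) ?e = ?r")
proof -
  let ?g = "\<lambda>l j. gconst ((of_int (int k) gchoose l) * (of_int (int k - int l) gchoose j) * (- 1) ^ j) * (- \<nu>) ^ l"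
  let ?p = "(nat (int k - x - y), nat y)"
  have e: "?e = (\<lambda>_. 0)(a := int k - int l - int j, b := int j)
      \<longleftrightarrow> int l = int k - x - y \<and> int j = y" for l j
    using assms by (auto simp: fun_eq_iff)
  have "spow a b \<nu> (int k) ?e = Sum_any (\<lambda>p. if p = ?p then
      if 0 \<le> y \<and> x + y \<le> int k then ?g (fst ?p) (snd ?p) else 0 else 0)"
    unfolding spow_def e by (intro Sum_any.cong) (auto split: if_splits)
  also have "\<dots> = (if 0 \<le> y \<and> x + y \<le> int k then ?g (fst ?p) (snd ?p) else 0)"
    by simp
  also have "\<dots> = ?r"
  proof (cases "0 \<le> y \<and> x + y \<le> int k")
    case True
    define l j where "l = nat (int k - x - y)" "j = nat y"
    then have lj: "y = int j" "x = int k - int l - int j"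
      using True by auto
    have "?g l j = ?r"
    proof (cases "l \<le> k")
      case l: True
      have "(of_int (int k - int l) gchoose j :: complex) = of_nat ((k - l) choose j)"
        using l by (simp add: binomial_gbinomial of_nat_diff)
      moreover have "(of_int (int k) gchoose l :: complex) = of_nat (k choose l)"
        by (simp add: binomial_gbinomial)
      moreover have "nat (x + y) = k - l"
        using l lj by auto
      \<comment> \<open>Here \<open>x + j = k - l\<close>, so a negative \<open>x\<close> means
        \<open>j > k - l\<close>.\<close>
      moreover have "(k - l) choose j = 0" if "\<not> 0 \<le> x"
        using that l lj by (intro binomial_eq_0) auto
      ultimately show ?thesis
        using True lj by (cases "0 \<le> x") (simp_all flip: l_j_def)
    next
      case l: False
      \<comment> \<open>Now \<open>k - l\<close> is negative and its binomials need not vanish; the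
        factor \<open>k choose l\<close> does.\<close>
      then have "(of_int (int k) gchoose l :: complex) = 0"
        by (simp add: binomial_eq_0 flip: binomial_gbinomial)
      moreover have "\<not> 0 \<le> x"
        using l lj by auto
      ultimately show ?thesis
        by simp
    qed
    then show ?thesis
      using True by (simp add: l_j_def)
  qed auto
  finally show ?thesis .
qed

lemma spow_support:
  assumes "e \<noteq> (\<lambda>_. 0)(a := e a, b := e b)" "a \<noteq> b"
  shows "spow a b \<nu> n e = 0"
proof -
  have "e \<noteq> (\<lambda>_. 0)(a := n - int k - int j, b := int j)" for k j
  proof
    assume "e = (\<lambda>_. 0)(a := n - int k - int j, b := int j)"
    with assms show False
      by simp
  qed
  then show ?thesis
    unfolding spow_def by (simp only: if_False case_prod_unfold) simp
qed

lemma finite_spow_nat: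
  assumes "a \<noteq> b"
  shows "finite {e. spow a b \<nu> (int k) e \<noteq> 0}"
proof (rule finite_subset)
  show "{e. spow a b \<nu> (int k) e \<noteq> 0} \<subseteq>
      (\<lambda>(x, y). (\<lambda>_. 0)(a := x, b := y)) ` ({0..int k} \<times> {0..int k})"
  proof
    fix e assume "e \<in> {e. spow a b \<nu> (int k) e \<noteq> 0}"
    then have e: "e = (\<lambda>_. 0)(a := e a, b := e b)" and "spow a b \<nu> (int k) e \<noteq> 0"
      using spow_support[OF _ assms] by auto
    then have "0 \<le> e a \<and> 0 \<le> e b \<and> e a + e b \<le> int k"
      using spow_nat[OF assms, of \<nu> k "e a" "e b"] by (auto split: if_splits)
    then show "e \<in> (\<lambda>(x, y). (\<lambda>_. 0)(a := x, b := y)) ` ({0..int k} \<times> {0..int k})"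
      by (intro image_eqI[of _ _ "(e a, e b)"]) (use e in auto)
  qed
qed simp

text \<open>Formally \<open>x_b - x_a + nu\<close> is the negative of \<open>x_a - x_b - nu\<close>.
  Since nonnegative powers are polynomials, the order of expansion is immaterial and only the sign
  \<open>(-1)^k\<close> remains.\<close>

lemma spow_nat_swap:
  assumes "a \<noteq> b"
  shows "ksgn (of_nat k) (spow b a (- \<nu>) (int k) e) = spow a b \<nu> (int k) e"
proof (cases "e = (\<lambda>_. 0)(a := e a, b := e b)")
  case True
  define x y where "x = e a" "y = e b"
  have e: "e = (\<lambda>_. 0)(a := x, b := y)" "e = (\<lambda>_. 0)(b := y, a := x)"
    using True assms by (auto simp: x_y_def fun_upd_twist)
  show ?thesis
  proof (cases "0 \<le> x \<and> 0 \<le> y \<and> x + y \<le> int k")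
    case xy: True
    define m n l where "m = nat x" "n = nat y" "l = nat (int k - x - y)"
    have k: "k = l + (m + n)" and nats: "x = int m" "y = int n"
      using xy by (auto simp: m_n_l_def)
    let ?B = "of_nat (k choose l) * of_nat ((m + n) choose n) :: complex"
    have 1: "spow a b \<nu> (int k) e = gconst (?B * (- 1) ^ n) * (- \<nu>) ^ l"
      unfolding e(1) spow_nat[OF assms] by (simp add: nats k)
        (simp add: nat_add_distrib)
    have "(m + n) choose m = (m + n) choose n"
      using binomial_symmetric[of m "m + n"] by simp
    then have 2: "spow b a (- \<nu>) (int k) e = gconst (?B * (- 1) ^ m) * \<nu> ^ l"
      unfolding e(2) spow_nat[OF assms[symmetric]] by (simp add: nats k)
        (simp add: nat_add_distrib add.commute)
    have pow: "(- 1) ^ j = ksgn (of_nat j) (1::complex)" "(- \<nu>) ^ j = ksgn (of_nat j) (\<nu> ^ j)" for j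
      by (induction j) (auto simp: ksgn_def)
    have gk: "gconst (c * ksgn i 1) = ksgn i (gconst c)" for c i
      by (simp add: ksgn_def gconst_uminus)
    \<comment> \<open>With \<open>k = l + m + n\<close>, the left side contains \<open>m\<close>
      twice, which cancels modulo 2.\<close>
    have "of_nat k + of_nat m = (of_nat n + of_nat l :: bit)"
      unfolding k by (cases "of_nat m :: bit"; simp add: ac_simps)
    then show ?thesis
      unfolding 1 2 pow gk by (simp add: ksgn_ksgn ksgn_mult_left ksgn_mult_right add.commute)
  next
    case False
    then have "\<not> (0 \<le> y \<and> 0 \<le> x \<and> y + x \<le> int k)"
      by auto
    then show ?thesis
      using False spow_nat[OF assms, of \<nu> k x y] spow_nat[OF assms[symmetric], of "- \<nu>" k y x] e
      by (metis ksgn_zero)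
  qed
next
  case False
  moreover from this have "e \<noteq> (\<lambda>_. 0)(b := e b, a := e a)"
    using assms by (metis fun_upd_twist)
  ultimately show ?thesis
    using assms by (simp add: spow_support)
qed


section \<open>The coefficient of a power of \<open>x\<^sub>0\<close> in the Jacobi identity\<close>

text \<open>When \<open>A\<close> does not involve \<open>x_0\<close>, the power
  \<open>x_0^(-k-1)\<close> can only come from the delta function, and there only from its summand
  \<open>n = k\<close>.\<close>

lemma scmult_sdelta_coeff:
  assumes A: "\<And>e S w. e X0 \<noteq> 0 \<Longrightarrow> A e S w = 0"
    and e: "e X0 = 0" and smul: "\<And>c. smul (gconst c) 0 = 0"
  shows "scmult smul (sdelta s a b \<nu> X0) A (e(X0 := - int k - 1)) S w =
    scmult smul (\<lambda>q. ksgn (s * of_nat k) (spow a b \<nu> (int k) q)) A e S w"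
proof -
  \<comment> \<open>The shift by \<open>x_0^(-k-1)\<close> matches exponents of the plain power with
    those of the delta function. Reindexing \<open>Sum_any\<close> along a bijection needs no
    finiteness of support.\<close>
  define h :: "(evar \<Rightarrow> int) \<Rightarrow> evar \<Rightarrow> int" where "h q = q(X0 := q X0 - int k - 1)" for q
  have "bij h"
    by (rule o_bij[of "\<lambda>q. q(X0 := q X0 + int k + 1)"]) (auto simp: h_def fun_eq_iff)
  have he: "e(X0 := - int k - 1) - h q = e - q" for q
    using e by (auto simp: h_def fun_eq_iff)
  show ?thesis
    unfolding scmult_def
  proof (rule Sum_any.reindex_cong[where l = h])
    show "(\<lambda>q. \<Sum>T\<in>Pow S. ksgn (shuf T (S - T)) (smul (gconst (gcoeff (sdelta s a b \<nu> X0 q) T))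
        (A (e(X0 := - int k - 1) - q) (S - T) w))) \<circ> h =
      (\<lambda>q. \<Sum>T\<in>Pow S. ksgn (shuf T (S - T)) (smul (gconst (gcoeff (ksgn (s * of_nat k)
        (spow a b \<nu> (int k) q)) T)) (A (e - q) (S - T) w)))"
      (is "?l = ?r")
    proof
      fix q
      show "?l q = ?r q"
      proof (cases "q X0 = 0")
        case True
        then have "sdelta s a b \<nu> X0 (h q) = ksgn (s * of_nat k) (spow a b \<nu> (int k) q)"
          by (simp add: sdelta_def h_def fun_upd_idem)
        then show ?thesis
          by (simp add: he)
      next
        case False
        then have "A (e - q) T w = 0" for T
          using e by (intro A) simp
        then show ?thesis
          by (simp add: he smul)
      qed
    qed
  qed (rule \<open>bij h\<close>)
qed

section \<open>Linearity, parity and support of vertex operators\<close>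

context N2_vertex_operators
begin

lemma Y_zero_left [simp]: "Y 0 n T w = 0"
  using Y_add[of 0 0 n T w] by simp

lemma Y_zero_right [simp]: "Y v n T 0 = 0"
  using End_add[of v n T 0 0] by simp

lemma field_at_zero [simp]: "field_at smul (Y u) a p m e S 0 = 0"
  by (simp add: field_at_def)

lemma field_at_support: "c \<noteq> a \<Longrightarrow> e c \<noteq> 0 \<Longrightarrow> field_at smul (Y u) a p m e S w = 0"
  unfolding field_at_def by (metis (no_types, lifting) fun_upd_other)

lemma field_at_add_left:
  "field_at smul (Y (u + v)) a p m e S w = field_at smul (Y u) a p m e S w + field_at smul (Y v) a p m e S w"
  by (simp add: field_at_def Y_add smul_add_right[OF gconst_in_Lam] sum.distrib)

lemma field_at_add_right:
  "field_at smul (Y u) a p m e S (w + w') = field_at smul (Y u) a p m e S w + field_at smul (Y u) a p m e S w'"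
  by (simp add: field_at_def End_add smul_add_right[OF gconst_in_Lam] sum.distrib)

text \<open>For odd \<open>p\<close> and \<open>m\<close>, the monomial with index \<open>S\<close>
  occurs in \<open>opow p m T\<close> only if \<open>S\<close> and \<open>T\<close> have equal
  parity, so the parity of the mode can be read off from \<open>S\<close>.\<close>

lemma field_at_parity:
  assumes "has_parity 1 p" "has_parity 1 m" "u \<in> V i" "w \<in> V j"
  shows "field_at smul (Y u) a p m e S w \<in> V (i + par S + j)"
proof -
  have "smul (gconst (gcoeff (opow p m T) S)) (Y u n T w) \<in> V (i + par S + j)" for n T
  proof (cases "gcoeff (opow p m T) S = 0")
    case True
    then show ?thesis
      by (simp add: V_zero)
  next
    case False
    then have "par S = par T"
      using has_parity_opow[OF assms(1,2)] by (simp add: has_parity_def)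
    then show ?thesis
      using V_smul[OF gconst_in_LamP Y_parity[OF assms(3,4)]] by simp
  qed
  then show ?thesis
    by (auto simp: field_at_def V_zero intro: V_sum)
qed

text \<open>Including the odd variables, a vertex operator has the parity of its vector. Thus the
  bilinear extension in \<open>supercomm\<close> amounts to splitting \<open>u\<close> and
  \<open>v\<close> into homogeneous components.\<close>

lemma espart_field_at:
  assumes "has_parity 1 p" "has_parity 1 m"
  shows "espart V i (field_at smul (Y u) a p m) = field_at smul (Y (vpart V i u)) a p m"
proof (intro ext)
  fix e S w
  let ?F = "\<lambda>u. field_at smul (Y u) a p m e S"
  \<comment> \<open>The component of \<open>u\<close> of parity \<open>i + 1\<close> lands in the
    opposite part, so the projection removes it.\<close>
  have "vpart V (i + par S + k) (?F u (vpart V k w)) = ?F (vpart V i u) (vpart V k w)" for k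
  proof -
    have "?F u (vpart V k w) = ?F (vpart V i u) (vpart V k w) + ?F (vpart V (i + 1) u) (vpart V k w)"
      using field_at_add_left[of "vpart V i u" "vpart V (i + 1) u" a p m e S "vpart V k w"]
      by (simp only: vpart_decomp)
    moreover have "?F (vpart V i u) (vpart V k w) \<in> V (i + par S + k)"
      by (intro field_at_parity assms vpart_mem)
    moreover have "?F (vpart V (i + 1) u) (vpart V k w) \<in> V (i + par S + k + 1)"
      using field_at_parity[OF assms vpart_mem[of "i + 1" u] vpart_mem[of k w]]
      by (simp only: add.assoc add.commute[of 1])
    ultimately show ?thesis
      by (simp only: vpart_add vpart_same[of "?F (vpart V i u) (vpart V k w)"]
        vpart_other[of "?F (vpart V (i + 1) u) (vpart V k w)"] add_0_right)
  qed
  then have "espart V i (field_at smul (Y u) a p m) e S w =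
      (\<Sum>k\<in>{0, 1}. ?F (vpart V i u) (vpart V k w))"
    unfolding espart_def epart_def by (simp only:)
  also have "\<dots> = ?F (vpart V i u) (vpart V 0 w + vpart V 1 w)"
    unfolding field_at_add_right by simp
  finally show "espart V i (field_at smul (Y u) a p m) e S w = ?F (vpart V i u) w"
    unfolding vpart_decomp[of 0 w, simplified] .
qed

lemma emult_field_at_support:
  assumes "e c \<noteq> 0" "c \<noteq> a" "c \<noteq> b"
  shows "emult V (field_at smul (Y u) a p m) (field_at smul (Y v) b p' m') e S w = 0"
proof -
  have "epart V i (field_at smul (Y u) a p m q T) (field_at smul (Y v) b p' m' (e - q) R w) = 0" for i q T R
  proof (cases "q c = 0")
    case True
    then have "field_at smul (Y v) b p' m' (e - q) R w = 0"
      using assms by (intro field_at_support[of c]) auto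
    then show ?thesis
      by (simp add: epart_def)
  next
    case False
    then have "field_at smul (Y u) a p m q T = (\<lambda>_. 0)"
      using assms by (intro ext field_at_support[of c]) auto
    then show ?thesis
      by (simp add: epart_zero_fun)
  qed
  then show ?thesis
    by (simp add: emult_def)
qed

lemma iterate_eq_0:
  assumes "\<And>n T. n \<ge> N \<Longrightarrow> Y u n T v = 0" "e X0 < - N"
  shows "iterate smul Y u v e S w = 0"
proof -
  \<comment> \<open>The outer field is free of \<open>x_0\<close>, so only
    \<open>q X0 = e X0\<close> matters. The inner mode then has index \<open>- e X0 - 1\<close>,
    which is at least \<open>N\<close>.\<close>
  have "field_at2 smul (Y (field_at smul (Y u) X0 p m q T v)) (e - q) R w = 0" for p m q T R
  proof (cases "q X0 = e X0")
    case True
    then have "field_at smul (Y u) X0 p m q T v = 0"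
      using assms by (simp add: field_at_def)
    then show ?thesis
      by (simp add: field_at_def)
  next
    case False
    then show ?thesis
      by (intro field_at_support[of X0]) auto
  qed
  then show ?thesis
    by (simp add: iterate_def)
qed

text \<open>The delta function is expanded in nonnegative powers of \<open>x_0\<close>, so the
  iterate enters only with \<open>x_0\<close>-exponents at most \<open>e X0\<close>, where
  truncation makes it vanish.\<close>

lemma jacobi_rhs_eq_0:
  assumes "\<And>n T. n \<ge> N \<Longrightarrow> Y u n T v = 0" "e X0 < - N"
  shows "scmult smul (sdelta 0 X1 X0 nu X2) (iterate smul Y u v) e S w = 0"
proof -
  have "smul (gconst (gcoeff (sdelta 0 X1 X0 nu X2 q) T)) (iterate smul Y u v (e - q) R w) = 0" for q T R
  proof (cases "q X0 < 0")
    case True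
    then have "sdelta 0 X1 X0 nu X2 q = 0"
      by (simp add: sdelta_def spow_eq_0)
    then show ?thesis
      by (simp add: zero_grassmann.rep_eq)
  next
    case False
    then have "iterate smul Y u v (e - q) R w = 0"
      using assms by (intro iterate_eq_0[of N]) auto
    then show ?thesis
      by simp
  qed
  then show ?thesis
    by (simp add: scmult_def)
qed

lemma homogeneous_commutator:
  assumes jacobi: "jacobi smul V Y" and uv: "u \<in> V i" "v \<in> V j"
    and N: "\<And>n T. n \<ge> int k \<Longrightarrow> Y u n T v = 0"
  shows "scmult smul (spow X1 X2 nu (int k)) (emult V (field_at1 smul (Y u)) (field_at2 smul (Y v))) e S w =
    ksgn (i * j)
      (scmult smul (spow X1 X2 nu (int k)) (emult V (field_at2 smul (Y v)) (field_at1 smul (Y u))) e S w)"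
    (is "scmult smul ?c ?A e S w = ksgn _ (scmult smul ?c ?B e S w)")
proof (cases "e X0 = 0")
  case True
  \<comment> \<open>This exponent selects the \<open>k\<close>-th power in both delta functions and
    lies strictly below \<open>- k\<close>, as \<open>jacobi_rhs_eq_0\<close> requires.\<close>
  let ?e = "e(X0 := - int k - 1)"
  have A: "scmult smul (sdelta 0 X1 X2 nu X0) ?A ?e S w = scmult smul ?c ?A e S w"
    by (subst scmult_sdelta_coeff) (auto simp: True emult_field_at_support[of _ X0])
  \<comment> \<open>The sign \<open>(-1)^k\<close> caused by the denominator \<open>- x_0\<close> is
    exactly the one absorbed by \<open>spow_nat_swap\<close>.\<close>
  have B: "scmult smul (sdelta 1 X2 X1 (- nu) X0) ?B ?e S w = scmult smul ?c ?B e S w"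
    by (subst scmult_sdelta_coeff) (auto simp: True emult_field_at_support[of _ X0] spow_nat_swap)
  have "scmult smul (sdelta 0 X1 X2 nu X0) ?A ?e S w
      - ksgn (i * j) (scmult smul (sdelta 1 X2 X1 (- nu) X0) ?B ?e S w) =
      scmult smul (sdelta 0 X1 X0 nu X2) (iterate smul Y u v) ?e S w"
    using jacobi uv unfolding jacobi_def by blast
  also have "\<dots> = 0"
    by (rule jacobi_rhs_eq_0[OF N]) auto
  finally show ?thesis
    unfolding A B by simp
next
  case False
  \<comment> \<open>Neither the power nor the products of fields involve \<open>x_0\<close>, so at a
    nonzero \<open>x_0\<close>-exponent both sides vanish.\<close>
  have "smul (gconst (gcoeff (?c q) T)) (M (e - q) R w) = 0"
    if M: "\<And>e R w. e X0 \<noteq> 0 \<Longrightarrow> M e R w = 0" for M :: "'v eseries" and q T R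
  proof (cases "q X0 = 0")
    case True
    then show ?thesis
      using M False by simp
  next
    case q: False
    then have "?c q = 0"
      by (intro spow_support) (auto simp: fun_eq_iff)
    then show ?thesis
      by (simp add: zero_grassmann.rep_eq)
  qed
  then show ?thesis
    by (simp add: scmult_def emult_field_at_support[of _ X0])
qed

lemma weak_supercommutativity:
  assumes "truncation Y" and jacobi: "jacobi smul V Y"
  shows "weak_supercommutativity smul V Y u v"
proof -
  let ?u = "\<lambda>i. vpart V i u" and ?v = "\<lambda>j. vpart V j v"
  obtain M where M: "\<And>u v n T. n \<ge> M u v \<Longrightarrow> Y u n T v = 0"
    using assms(1) unfolding truncation_def by metis
  define N where "N i j = M (?u i) (?v j)" for i j
  have N: "Y (?u i) n T (?v j) = 0" if "n \<ge> N i j" for i j n T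
    using that M by (simp add: N_def)
  \<comment> \<open>One power must serve all four pairs of homogeneous components. Inserting
    \<open>1\<close> makes it positive, and \<open>nat\<close> covers negative truncation
    bounds.\<close>
  define k where "k = Max (insert 1 (range (\<lambda>(i, j). nat (N i j))))"
  have fin: "finite (range (\<lambda>(i, j). nat (N i j)))"
    by (rule finite_subset[of _ "(\<lambda>(i, j). nat (N i j)) ` ({0, 1} \<times> {0, 1})"])
      (auto simp: image_iff, metis bit.exhaust)
  have k: "k > 0" "N i j \<le> int k" for i j
  proof -
    show "k > 0"
      using Max_ge[of "insert 1 (range (\<lambda>(i, j). nat (N i j)))" 1] fin by (simp add: k_def)
    have "nat (N i j) \<le> k"
      unfolding k_def by (rule Max_ge) (use fin in \<open>auto intro!: insertI2 image_eqI[of _ _ "(i, j)"]\<close>)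
    then show "N i j \<le> int k"
      by simp
  qed
  let ?c = "spow X1 X2 nu (int k)"
  let ?A = "\<lambda>i j. emult V (field_at1 smul (Y (?u i))) (field_at2 smul (Y (?v j)))"
  let ?B = "\<lambda>i j. emult V (field_at2 smul (Y (?v j))) (field_at1 smul (Y (?u i)))"
  have c: "finite {q. ?c q \<noteq> 0}"
    by (rule finite_spow_nat) simp
  have comm: "scmult smul ?c (?A i j) e S w = ksgn (i * j) (scmult smul ?c (?B i j) e S w)" for i j e S w
    by (rule homogeneous_commutator[OF jacobi vpart_mem vpart_mem]) (rule N, rule order_trans[OF k(2)])
  have "scmult smul ?c (supercomm V (field_at1 smul (Y u)) (field_at2 smul (Y v))) e S w = 0" for e S w
  proof -
    \<comment> \<open>Finite support of \<open>?c\<close> lets multiplication distribute over the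
      four homogeneous supercommutators, each of which is then zero by \<open>comm\<close>.\<close>
    have "scmult smul ?c (supercomm V (field_at1 smul (Y u)) (field_at2 smul (Y v))) e S w =
        (\<Sum>i\<in>{0, 1}. \<Sum>j\<in>{0, 1}. scmult smul ?c (?A i j) e S w - ksgn (i * j) (scmult smul ?c (?B i j) e S w))"
      unfolding supercomm_def espart_field_at[OF has_parity_ggen has_parity_ggen]
        scmult_sum[OF c] scmult_diff[OF c] scmult_ksgn[OF c] ..
    then show ?thesis
      unfolding comm by simp
  qed
  then show ?thesis
    unfolding weak_supercommutativity_def using k(1) by blast
qed

end

theorem proposition3p1:
  fixes L :: enat
    and smul :: "nat grassmann \<Rightarrow> 'v::ab_group_add \<Rightarrow> 'v"
    and V :: "bit \<Rightarrow> 'v set"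
    and Y :: "'v \<Rightarrow> 'v field"
    and vac :: 'v
  shows "(N2_vertex_superalgebra L smul V Y vac \<longrightarrow>
           (\<forall>u v. weak_supercommutativity smul V Y u v)) \<and>
         (N2_vertex_operators L smul V Y \<and> truncation Y \<and> jacobi smul V Y \<longrightarrow>
           (\<forall>u v. weak_supercommutativity smul V Y u v))"
proof -
  have "weak_supercommutativity smul V Y u v"
    if "N2_vertex_operators L smul V Y" "truncation Y" "jacobi smul V Y" for u v
    using that by (rule N2_vertex_operators.weak_supercommutativity)
  moreover have "N2_vertex_operators L smul V Y" "truncation Y" "jacobi smul V Y"
    if "N2_vertex_superalgebra L smul V Y vac"
    using that by (rule N2_vertex_superalgebra.axioms N2_vertex_superalgebra.truncation
        N2_vertex_superalgebra.jacobi)+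
  ultimately show ?thesis
    by blast
qed

end
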